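(* Let $X$ be a treatment variable with $m$ values $x_1,\dots,x_m$ and $Y$ an effect variable with $n$ values $y_1,\dots,y_n$ in a structural causal model. Let $1\le i,k\le n$ and $1\le j,p\le m$ with $j\ne p$. Then $$\max\{0,\ P(Y_{x_j}=y_i)+P(X=x_p,Y=y_k)-1+P(X=x_j)-P(X=x_j,Y=y_i)\}\ \le\ P(Y_{x_j}=y_i,\,Y=y_k,\,X=x_p)$$ and $$P(Y_{x_j}=y_i,\,Y=y_k,\,X=x_p)\ \le\ \min\{P(Y_{x_j}=y_i)-P(X=x_j,Y=y_i),\ P(X=x_p,Y=y_k)\}.$$
   Context: $Y_{x_j}$ denotes the counterfactual (potential outcome) variable "the value $Y$ would have, had $X$ been $x_j$". The structural causal model induces one probability space $P$ on which $X$, $Y$, and $Y_{x_1},\dots,Y_{x_m}$ (each with values in $\{y_1,\dots,y_n\}$) are jointly defined, and they satisfy consistency: on the event $X=x_j$ one has $Y_{x_j}=Y$ (so $P(Y_{x_j}=y_i,X=x_j)=P(X=x_j,Y=y_i)$). The values $x_1,\dots,x_m$ are distinct, as are $y_1,\dots,y_n$. *)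

theory Defs
  imports "HOL-Probability.Probability"
begin

text \<open>
  A treatment X with the m distinct values x 1, ..., x m, an effect Y with the n distinct
  values y 1, ..., y n, and the counterfactual variables of Y, all defined jointly on one
  probability space M.  The variable Ycf (x j) is the value Y would have, had X been x j.
  No independence or exogeneity assumption is made: the only link between Ycf, X and Y
  is consistency.
\<close>

locale counterfactual_model = prob_space M
  for M :: "'w measure" +
  fixes X :: "'w \<Rightarrow> 'a"
    and Y :: "'w \<Rightarrow> 'b"
    and Ycf :: "'a \<Rightarrow> 'w \<Rightarrow> 'b"
    and x :: "nat \<Rightarrow> 'a" and m :: nat
    and y :: "nat \<Rightarrow> 'b" and n :: nat
  assumes x_distinct: "inj_on x {1..m}"
    and y_distinct: "inj_on y {1..n}"
    and X_rv: "X \<in> measurable M (count_space (x ` {1..m}))"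
    and Y_rv: "Y \<in> measurable M (count_space (y ` {1..n}))"
    and Ycf_rv: "\<And>j. j \<in> {1..m} \<Longrightarrow> Ycf (x j) \<in> measurable M (count_space (y ` {1..n}))"
    and consistency: "\<And>j \<omega>. \<lbrakk>j \<in> {1..m}; \<omega> \<in> space M; X \<omega> = x j\<rbrakk> \<Longrightarrow> Ycf (x j) \<omega> = Y \<omega>"

text \<open>
  The remainder shows that structural causal models induce counterfactual models.  The
  exogenous state is a point u of a probability space; the endogenous variables z in V take
  values in D z and are determined by the structural equations v z = F z u v.
  The intervention do(T = t) replaces the equation of T by the constant t.
\<close>

definition scm_solution ::
  "'v set \<Rightarrow> ('v \<Rightarrow> 'a set) \<Rightarrow> ('v \<Rightarrow> 'w \<Rightarrow> ('v \<Rightarrow> 'a) \<Rightarrow> 'a) \<Rightarrow> 'w \<Rightarrow> ('v \<Rightarrow> 'a) \<Rightarrow> bool" where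
  "scm_solution V D F u v \<longleftrightarrow> v \<in> Pi\<^sub>E V D \<and> (\<forall>z\<in>V. v z = F z u v)"

definition scm_value ::
  "'v set \<Rightarrow> ('v \<Rightarrow> 'a set) \<Rightarrow> ('v \<Rightarrow> 'w \<Rightarrow> ('v \<Rightarrow> 'a) \<Rightarrow> 'a) \<Rightarrow> 'v \<Rightarrow> 'w \<Rightarrow> 'a" where
  "scm_value V D F z u = (THE v. scm_solution V D F u v) z"

definition scm_do ::
  "('v \<Rightarrow> 'w \<Rightarrow> ('v \<Rightarrow> 'a) \<Rightarrow> 'a) \<Rightarrow> 'v \<Rightarrow> 'a \<Rightarrow> ('v \<Rightarrow> 'w \<Rightarrow> ('v \<Rightarrow> 'a) \<Rightarrow> 'a)" where
  "scm_do F T t = F(T := (\<lambda>_ _. t))"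

locale structural_causal_model = prob_space M
  for M :: "'w measure" +
  fixes V :: "'v set"
    and D :: "'v \<Rightarrow> 'a set"
    and F :: "'v \<Rightarrow> 'w \<Rightarrow> ('v \<Rightarrow> 'a) \<Rightarrow> 'a"
  assumes finite_V: "finite V"
    and solution: "\<And>u. u \<in> space M \<Longrightarrow> \<exists>!v. scm_solution V D F u v"
    and solution_do: "\<And>u T t. \<lbrakk>u \<in> space M; T \<in> V; t \<in> D T\<rbrakk> \<Longrightarrow>
          \<exists>!v. scm_solution V D (scm_do F T t) u v"
    and value_rv: "\<And>z. z \<in> V \<Longrightarrow> scm_value V D F z \<in> measurable M (count_space (D z))"
    and value_do_rv: "\<And>z T t. \<lbrakk>z \<in> V; T \<in> V; t \<in> D T\<rbrakk> \<Longrightarrow>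
          scm_value V D (scm_do F T t) z \<in> measurable M (count_space (D z))"

lemma (in structural_causal_model) induces_counterfactual_model:
  assumes T: "T \<in> V" and S: "S \<in> V"
    and x: "bij_betw x {1..m} (D T)" and y: "bij_betw y {1..n} (D S)"
  shows "counterfactual_model M (scm_value V D F T) (scm_value V D F S)
           (\<lambda>t. scm_value V D (scm_do F T t) S) x m y n"
proof -
  have xD: "x ` {1..m} = D T" and yD: "y ` {1..n} = D S"
    using x y by (auto simp: bij_betw_def)
  have xj: "x j \<in> D T" if "j \<in> {1..m}" for j
    using that xD by auto
  have cons: "scm_value V D (scm_do F T (x j)) S u = scm_value V D F S u"
    if j: "j \<in> {1..m}" and u: "u \<in> space M" and eq: "scm_value V D F T u = x j" for j u
  proof -
    define v where "v = (THE v. scm_solution V D F u v)"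
    have v: "scm_solution V D F u v"
      unfolding v_def using theI'[OF solution[OF u]] .
    have "v T = x j"
      using eq by (simp add: scm_value_def v_def)
    with v have "scm_solution V D (scm_do F T (x j)) u v"
      by (auto simp: scm_solution_def scm_do_def)
    then have "(THE v. scm_solution V D (scm_do F T (x j)) u v) = v"
      using solution_do[OF u T xj[OF j]] by (intro the1_equality)
    then show ?thesis
      by (simp add: scm_value_def v_def)
  qed
  show ?thesis
  proof
    show "inj_on x {1..m}" "inj_on y {1..n}"
      using x y by (auto simp: bij_betw_def)
    show "scm_value V D F T \<in> measurable M (count_space (x ` {1..m}))"
      unfolding xD by (rule value_rv[OF T])
    show "scm_value V D F S \<in> measurable M (count_space (y ` {1..n}))"
      unfolding yD by (rule value_rv[OF S])
    show "scm_value V D (scm_do F T (x j)) S \<in> measurable M (count_space (y ` {1..n}))"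
      if "j \<in> {1..m}" for j
      unfolding yD by (rule value_do_rv[OF S T xj[OF that]])
  qed (use cons in auto)
qed

end

theory Submission
  imports Defs
begin

text \<open>
  By consistency, the event X = x j, Y = y i is the part of the event Ycf (x j) = y i on which
  X = x j.  Removing it leaves an event which, like the event X = x p, Y = y k, is disjoint
  from X = x j.  The bounds are therefore the Frechet bounds for the intersection of two
  subevents of the complement of X = x j.
\<close>

lemma (in prob_space) frechet_bounds_disjoint:
  assumes [measurable]: "A \<in> events" "B \<in> events" "C \<in> events"
    and BC: "B \<inter> C = {}"
  shows "max 0 (prob A + prob B - 1 + prob C - prob (A \<inter> C)) \<le> prob (A \<inter> B)"
    and "prob (A \<inter> B) \<le> min (prob A - prob (A \<inter> C)) (prob B)"
proof -
  have A: "prob (A - C) = prob A - prob (A \<inter> C)"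
    by (simp add: finite_measure_Diff')
  \<comment> \<open>Since \<open>B\<close> misses \<open>C\<close>, trimming \<open>A\<close> to
    \<open>A - C\<close> leaves the intersection with \<open>B\<close> unchanged; the bounds sharpen
    because \<open>A - C\<close> replaces \<open>A\<close>.\<close>
  have AB: "A \<inter> B = (A - C) \<inter> B"
    using BC by auto
  \<comment> \<open>Inclusion-exclusion: both sets avoid \<open>C\<close>, so their union has
    probability at most \<open>1 - prob C\<close> instead of the trivial 1.\<close>
  have "prob (A - C) + prob B - prob (A \<inter> B) = prob ((A - C) \<union> B)"
    using measure_Un3[of "A - C" M B] by (simp add: AB fmeasurable_eq_sets)
  also have "\<dots> \<le> prob (space M - C)"
    using BC sets.sets_into_space[OF assms(1)] sets.sets_into_space[OF assms(2)]
    by (intro finite_measure_mono) auto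
  also have "\<dots> = 1 - prob C"
    by (simp add: prob_compl)
  finally show "max 0 (prob A + prob B - 1 + prob C - prob (A \<inter> C)) \<le> prob (A \<inter> B)"
    using A by simp
  have "prob (A \<inter> B) \<le> prob (A - C)" "prob (A \<inter> B) \<le> prob B"
    unfolding AB by (auto intro!: finite_measure_mono)
  with A show "prob (A \<inter> B) \<le> min (prob A - prob (A \<inter> C)) (prob B)"
    by simp
qed

theorem theorem7:
  fixes M :: "'w measure"
    and X :: "'w \<Rightarrow> 'a" and Y :: "'w \<Rightarrow> 'b" and Ycf :: "'a \<Rightarrow> 'w \<Rightarrow> 'b"
    and x :: "nat \<Rightarrow> 'a" and y :: "nat \<Rightarrow> 'b"
    and m n i k j p :: nat
  assumes "counterfactual_model M X Y Ycf x m y n"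
    and "1 \<le> i" "i \<le> n" and "1 \<le> k" "k \<le> n"
    and "1 \<le> j" "j \<le> m" and "1 \<le> p" "p \<le> m"
    and "j \<noteq> p"
  shows "max 0 (\<P>(\<omega> in M. Ycf (x j) \<omega> = y i) + \<P>(\<omega> in M. X \<omega> = x p \<and> Y \<omega> = y k) - 1
               + \<P>(\<omega> in M. X \<omega> = x j) - \<P>(\<omega> in M. X \<omega> = x j \<and> Y \<omega> = y i))
           \<le> \<P>(\<omega> in M. Ycf (x j) \<omega> = y i \<and> Y \<omega> = y k \<and> X \<omega> = x p)
       \<and> \<P>(\<omega> in M. Ycf (x j) \<omega> = y i \<and> Y \<omega> = y k \<and> X \<omega> = x p)
           \<le> min (\<P>(\<omega> in M. Ycf (x j) \<omega> = y i) - \<P>(\<omega> in M. X \<omega> = x j \<and> Y \<omega> = y i))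
                 (\<P>(\<omega> in M. X \<omega> = x p \<and> Y \<omega> = y k))"
proof -
  interpret counterfactual_model M X Y Ycf x m y n by fact
  have j: "j \<in> {1..m}" and p: "p \<in> {1..m}"
    using assms by auto
  \<comment> \<open>Measurability into \<open>count_space S\<close> only speaks of subsets of
    \<open>S\<close>. For \<open>c\<close> outside \<open>S\<close> the level set is empty, so the
    claim holds for every \<open>c\<close> and its uses need no membership check.\<close>
  have event: "{\<omega> \<in> space M. f \<omega> = c} \<in> events"
    if "f \<in> measurable M (count_space S)" for f :: "'w \<Rightarrow> 'c" and S c
  proof (cases "c \<in> S")
    case True
    then show ?thesis
      using measurable_sets[OF that, of "{c}"] by (simp add: vimage_def Int_def conj_commute)
  next
    case False
    then have "{\<omega> \<in> space M. f \<omega> = c} = {}"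
      using measurable_space[OF that] by auto
    then show ?thesis
      by (metis sets.empty_sets)
  qed
  let ?A = "{\<omega> \<in> space M. Ycf (x j) \<omega> = y i}"
  let ?B = "{\<omega> \<in> space M. X \<omega> = x p \<and> Y \<omega> = y k}"
  let ?C = "{\<omega> \<in> space M. X \<omega> = x j}"
  have A: "?A \<in> events" and C: "?C \<in> events"
    using event[OF Ycf_rv[OF j]] event[OF X_rv] by auto
  have B: "?B \<in> events"
    by (intro sets.sets_Collect_conj event[OF X_rv] event[OF Y_rv])
  \<comment> \<open>Distinctness of the treatment values turns \<open>j \<noteq> p\<close> into
    disjointness of \<open>?B\<close> and \<open>?C\<close>.\<close>
  have "x j \<noteq> x p"
    using inj_onD[OF x_distinct _ j p] \<open>j \<noteq> p\<close> by auto
  then have "?B \<inter> ?C = {}"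
    by auto
  note bounds = frechet_bounds_disjoint[OF A B C this]
  \<comment> \<open>Consistency enters here: where \<open>X\<close> equals \<open>x j\<close>, the
    counterfactual agrees with \<open>Y\<close>, so \<open>prob (?A \<inter> ?C)\<close> becomes a
    probability of observed variables.\<close>
  have "?A \<inter> ?C = {\<omega> \<in> space M. X \<omega> = x j \<and> Y \<omega> = y i}"
    using consistency[OF j] by auto
  moreover have "?A \<inter> ?B = {\<omega> \<in> space M. Ycf (x j) \<omega> = y i \<and> Y \<omega> = y k \<and> X \<omega> = x p}"
    by auto
  ultimately show ?thesis
    using bounds by simp
qed

end
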